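(* Let $0<|q|<1$. With $S(0,-1;q,N)$ the polynomial in $q$ defined in the context, the following limits hold (with $M$ running over the non-negative integers): $$\lim_{M\to\infty}S(0,-1;q^{-1},3M+1)\,q^{(M+1)(3M+2)}=\sum_{a,b\ge 0}\frac{q^{a^2-3ab+3b^2+a-2b}}{(q^3;q^3)_b}\begin{bmatrix}3b-a-2\\ a\end{bmatrix}_q,$$ $$\lim_{M\to\infty}S(0,-1;q^{-1},3M)\,q^{M(3M+2)}=\sum_{a,b\ge 0}\frac{q^{a^2-3ab+3b^2+a-2b}}{(q^3;q^3)_b}\begin{bmatrix}3b-a-1\\ a\end{bmatrix}_q,$$ $$\lim_{M\to\infty}S(0,-1;q^{-1},3M+2)\,q^{(M+1)(3M+2)}=\sum_{a,b\ge 0}\frac{q^{a^2-3ab+3b^2+a-2b}}{(q^3;q^3)_b}\begin{bmatrix}3b-a\\ a\end{bmatrix}_q.$$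
   Context: Here $q$ is a nonzero complex number with $|q|<1$, and $(x;q)_n=\prod_{i=0}^{n-1}(1-q^ix)$. For $k,l\in\mathbb{Z}$ the Gaussian binomial coefficient is $\begin{bmatrix}k\\ l\end{bmatrix}_q=\frac{(q;q)_k}{(q;q)_l(q;q)_{k-l}}$ if $k\ge l\ge 0$, and $0$ if $l<0$ or $k<l$ (in particular $\begin{bmatrix}-1\\ 0\end{bmatrix}_q=0$); the subscript $q^3$ means that $q$ is replaced by $q^3$. For an integer $N\ge 0$, $$S(0,-1;q,N)=\sum_{m,n\ge 0}q^{m^2+3mn+3n^2-n}\begin{bmatrix}N+1-3n-m\\ m\end{bmatrix}_q\begin{bmatrix}\lfloor\frac23(N+2)\rfloor-m-n\\ n\end{bmatrix}_{q^3},$$ a polynomial in $q$, and $S(0,-1;q^{-1},N)$ is the result of substituting $q^{-1}$ for $q$ in it. *)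

theory Defs
  imports "HOL-Analysis.Analysis"
begin

definition qpoch :: "complex \<Rightarrow> complex \<Rightarrow> nat \<Rightarrow> complex" where
  "qpoch x q n = (\<Prod>i<n. 1 - q ^ i * x)"

text \<open>The quotient agrees with the Gaussian polynomial evaluated at \<open>q\<close> unless some
  denominator factor vanishes, that is, unless \<open>q\<close> is a root of unity.  In particular it
  does so for \<open>norm q < 1\<close> and for \<open>norm q > 1\<close>.\<close>

definition gauss_binomial :: "complex \<Rightarrow> int \<Rightarrow> int \<Rightarrow> complex" where
  "gauss_binomial q k l =
     (if 0 \<le> l \<and> l \<le> k
      then qpoch q q (nat k) / (qpoch q q (nat l) * qpoch q q (nat (k - l)))
      else 0)"

text \<open>\<open>S q N\<close> is the value at \<open>q\<close> of the polynomial \<open>S(0,-1;q,N)\<close>; hence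
  \<open>S (inverse q) N\<close> is the value at \<open>q\<close> of \<open>S(0,-1;q\<inverse>,N)\<close>.  Only finitely many terms of
  the sum are nonzero (lemma \<open>S_finite_sum\<close>).  The exponent is nonnegative for all
  naturals \<open>m\<close> and \<open>n\<close>; it is computed in the integers to avoid truncated subtraction.\<close>

definition S :: "complex \<Rightarrow> nat \<Rightarrow> complex" where
  "S q N = (\<Sum>\<^sub>\<infinity>(m, n)\<in>(UNIV :: (nat \<times> nat) set).
     q powi ((int m)\<^sup>2 + 3 * int m * int n + 3 * (int n)\<^sup>2 - int n)
     * gauss_binomial q (int N + 1 - 3 * int n - int m) (int m)
     * gauss_binomial (q ^ 3) (\<lfloor>2 / 3 * (real N + 2)\<rfloor> - int m - int n) (int n))"

lemma S_finite_sum: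
  "S q N = (\<Sum>(m, n)\<in>{..N + 1} \<times> {..N + 1}.
     q powi ((int m)\<^sup>2 + 3 * int m * int n + 3 * (int n)\<^sup>2 - int n)
     * gauss_binomial q (int N + 1 - 3 * int n - int m) (int m)
     * gauss_binomial (q ^ 3) (\<lfloor>2 / 3 * (real N + 2)\<rfloor> - int m - int n) (int n))"
proof -
  have nz: "m \<le> Suc N" "n \<le> Suc N"
    if "gauss_binomial q (int N + 1 - 3 * int n - int m) (int m) \<noteq> 0" for m n
    using that by (auto simp: gauss_binomial_def split: if_splits)
  show ?thesis
    unfolding S_def
    by (subst infsum_finite[symmetric], simp, rule infsum_cong_neutral) (auto dest: nz)
qed

text \<open>The three limits are double sums whose terms differ only in the constant \<open>c\<close>.\<close>

definition limit_term :: "complex \<Rightarrow> int \<Rightarrow> nat \<times> nat \<Rightarrow> complex" where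
  "limit_term q c = (\<lambda>(a, b).
     q powi ((int a)\<^sup>2 - 3 * int a * int b + 3 * (int b)\<^sup>2 + int a - 2 * int b)
     / qpoch (q ^ 3) (q ^ 3) b
     * gauss_binomial q (3 * int b - int a - c) (int a))"

end

theory Submission
  imports Defs
begin

text \<open>
  Write \<open>A = N + 1\<close> and \<open>K = \<lfloor>2 (N + 2) / 3\<rfloor>\<close>.  Replacing \<open>q\<close> by its
  inverse in a Gaussian binomial with indices \<open>k\<close>, \<open>l\<close> only multiplies it by \<open>q\<close> to the power
  \<open>- l (k - l)\<close> (\<open>gauss_binomial_inverse\<close>).
  In the sum for \<open>S (inverse q) N\<close>, take as new summation variables the complementary lower
  indices \<open>a = A - 3n - 2m\<close> and \<open>b = K - m - 2n\<close> of the two binomials.  This substitution is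
  unimodular, hence a bijection of the integer pairs, and on the terms that do not vanish both
  pairs of variables are nonnegative.  After multiplication by \<open>q\<close> to the power
  \<open>A\<^sup>2 - 3AK + 3K\<^sup>2 + A - 2K\<close>, the term becomes \<open>q\<close> to the power
  \<open>a\<^sup>2 - 3ab + 3b\<^sup>2 + a - 2b\<close>, times the Gaussian binomial in \<open>q\<close> with indices
  \<open>3b - a - (3K - 2A)\<close>, \<open>a\<close>, times the one in \<open>q\<^sup>3\<close> with indices \<open>2K - A + a - b\<close>, \<open>b\<close>
  (\<open>S_inverse_eq\<close>).

  In a fixed residue class of \<open>N\<close> modulo 3 the number \<open>c = 3K - 2A\<close> is constant, equal to 1, 2
  or 0 for the residues 0, 1 or 2, while \<open>2K - A\<close> is \<open>M\<close> plus a constant.  So \<open>M\<close> enters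
  only through the upper index of the last binomial, and that binomial tends to
  \<open>1 / (q\<^sup>3; q\<^sup>3)\<^sub>b\<close>.  Limit and sum may be interchanged by dominated convergence: the Gaussian binomials are bounded uniformly
  in their indices, because \<open>(q; q)\<^sub>n\<close> never vanishes and has a nonzero limit, and the exponent of \<open>q\<close> is at
  least \<open>a + b - 3\<close>.
\<close>

section \<open>Gaussian binomials\<close>

lemma qpoch_Suc_self: "qpoch q q (Suc n) = (1 - q ^ Suc n) * qpoch q q n"
  by (simp add: qpoch_def mult.commute)

lemma qpoch_inverse:
  assumes "q \<noteq> 0"
  shows "qpoch (inverse q) (inverse q) n * q ^ (\<Sum>i<n. Suc i) = (-1) ^ n * qpoch q q n"
proof (induction n)
  case 0
  show ?case by (simp add: qpoch_def)
next
  case (Suc n)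
  have "(1 - inverse q ^ Suc n) * q ^ Suc n = - (1 - q ^ Suc n)"
    using assms by (simp add: field_simps)
  moreover have "qpoch (inverse q) (inverse q) (Suc n) * q ^ (\<Sum>i<Suc n. Suc i)
      = ((1 - inverse q ^ Suc n) * q ^ Suc n)
        * (qpoch (inverse q) (inverse q) n * q ^ (\<Sum>i<n. Suc i))"
    by (simp only: qpoch_Suc_self sum.lessThan_Suc power_add ac_simps)
  ultimately show ?case
    by (simp only: Suc.IH qpoch_Suc_self) (simp add: algebra_simps)
qed

lemma sum_Suc_add:
  "(\<Sum>i<l + r. Suc i) = (\<Sum>i<l. Suc i) + (\<Sum>i<r. Suc i) + l * r"
  by (induction r) auto

lemma gauss_binomial_inverse:
  assumes "q \<noteq> 0"
  shows "gauss_binomial (inverse q) k l = q powi (- (l * (k - l))) * gauss_binomial q k l"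
proof (cases "0 \<le> l \<and> l \<le> k")
  case True
  define m n where "m = nat l" and "n = nat (k - l)"
  have lk: "l = int m" "k = int (m + n)"
    using True by (auto simp: m_def n_def)
  define T where "T j = q ^ (\<Sum>i<j. Suc i)" for j
  have T0: "T j \<noteq> 0" for j
    using assms by (simp add: T_def)
  define Q where "Q = qpoch (inverse q) (inverse q)"
  \<comment> \<open>The signs cancel in the quotient, and the powers \<open>T\<close> combine by \<open>Tadd\<close>.\<close>
  have P: "Q j = (-1) ^ j * qpoch q q j / T j" for j
    using qpoch_inverse[OF assms, of j] T0[of j] by (simp add: T_def Q_def nonzero_eq_divide_eq)
  have Tadd: "T (m + n) = T m * T n * q ^ (m * n)"
    by (simp add: T_def sum_Suc_add power_add)
  have pw: "q powi (- (l * (k - l))) = inverse (q ^ (m * n))"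
    by (simp add: lk power_int_minus flip: of_nat_mult)
  have "gauss_binomial (inverse q) k l = Q (m + n) / (Q m * Q n)"
    by (simp add: gauss_binomial_def lk Q_def nat_add_distrib)
  also have "\<dots> = inverse (q ^ (m * n)) * (qpoch q q (m + n) / (qpoch q q m * qpoch q q n))"
    using T0 assms by (simp add: P Tadd power_add divide_simps)
  also have "\<dots> = inverse (q ^ (m * n)) * gauss_binomial q k l"
    by (simp add: gauss_binomial_def lk nat_add_distrib)
  finally show ?thesis
    by (simp only: pw)
next
  case False
  hence "gauss_binomial p k l = 0" for p
    by (auto simp: gauss_binomial_def)
  thus ?thesis
    by simp
qed

lemma gauss_binomial_symmetric: "gauss_binomial q k (k - l) = gauss_binomial q k l"
  by (auto simp: gauss_binomial_def mult.commute)

lemma qpoch_nonzero: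
  fixes q :: complex
  assumes "norm q < 1"
  shows "qpoch q q n \<noteq> 0"
proof -
  have "q ^ i * q \<noteq> 1" for i
  proof -
    have "norm q ^ Suc i < 1"
      using assms by (simp only: power_less_one_iff[OF norm_ge_zero] zero_less_Suc simp_thms)
    hence "norm (q ^ i * q) < norm (1 :: complex)"
      by (simp only: norm_mult norm_power norm_one power_Suc2)
    thus ?thesis
      by (metis less_irrefl)
  qed
  thus ?thesis
    by (auto simp: qpoch_def)
qed

text \<open>The nonvanishing of the limit gives both the bound and the limits of the Gaussian
  binomials below.\<close>

lemma qpoch_limit:
  fixes q :: complex
  assumes "norm q < 1"
  obtains L where "L \<noteq> 0" "qpoch q q \<longlonglongrightarrow> L"
proof -
  have nz: "1 - q ^ i * q \<noteq> 0" for i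
    using qpoch_nonzero[OF assms, of "Suc i"] by (simp add: qpoch_def)
  have "summable (\<lambda>i. norm ((1 - q ^ i * q) - 1))"
    using assms by (auto simp: norm_mult norm_power intro!: summable_mult2 summable_geometric)
  hence "convergent_prod (\<lambda>i. 1 - q ^ i * q)"
    by (intro abs_convergent_prod_imp_convergent_prod summable_imp_abs_convergent_prod)
  then obtain L where "(\<lambda>n. \<Prod>i\<le>n. 1 - q ^ i * q) \<longlonglongrightarrow> L" "L \<noteq> 0"
    using convergent_prod_iff_nz_lim[of "\<lambda>i. 1 - q ^ i * q"] nz by auto
  moreover from this(1) have "qpoch q q \<longlonglongrightarrow> L"
    unfolding qpoch_def by (subst LIMSEQ_lessThan_iff_atMost)
  ultimately show ?thesis
    using that by blast
qed

lemma gauss_binomial_bounded: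
  fixes q :: complex
  assumes "norm q < 1"
  obtains C where "C > 0" "\<And>k l. norm (gauss_binomial q k l) \<le> C"
proof -
  obtain L where L: "L \<noteq> 0" "qpoch q q \<longlonglongrightarrow> L"
    using qpoch_limit[OF assms] .
  have "Bseq (qpoch q q)"
    using L(2) by (intro convergent_imp_Bseq) (auto simp: convergent_def)
  then obtain A where A: "A > 0" "\<And>n. norm (qpoch q q n) \<le> A"
    by (auto elim: BseqE)
  have "Bseq (\<lambda>n. inverse (qpoch q q n))"
    using tendsto_inverse[OF L(2,1)] by (intro convergent_imp_Bseq) (auto simp: convergent_def)
  then obtain B where B: "B > 0" "\<And>n. norm (inverse (qpoch q q n)) \<le> B"
    by (auto elim: BseqE)
  show ?thesis
  proof
    show "A * B * B > 0"
      using A(1) B(1) by simp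
    show "norm (gauss_binomial q k l) \<le> A * B * B" for k l
    proof (cases "0 \<le> l \<and> l \<le> k")
      case True
      hence "norm (gauss_binomial q k l) = norm (qpoch q q (nat k))
          * norm (inverse (qpoch q q (nat l))) * norm (inverse (qpoch q q (nat (k - l))))"
        by (simp add: gauss_binomial_def norm_mult norm_divide norm_inverse field_simps)
      also have "\<dots> \<le> A * B * B"
        using A(1) B(1) by (intro mult_mono A(2) B(2) mult_nonneg_nonneg norm_ge_zero) simp_all
      finally show ?thesis .
    next
      case False
      hence "gauss_binomial q k l = 0"
        by (auto simp: gauss_binomial_def)
      thus ?thesis
        using A(1) B(1) by simp
    qed
  qed
qed

lemma gauss_binomial_tendsto:
  fixes q :: complex
  assumes "norm q < 1"
  shows "(\<lambda>M. gauss_binomial q (int M + d) (int b)) \<longlonglongrightarrow> 1 / qpoch q q b"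
proof -
  obtain L where L: "L \<noteq> 0" "qpoch q q \<longlonglongrightarrow> L"
    using qpoch_limit[OF assms] .
  have at_top: "filterlim (\<lambda>M. nat (int M + e)) at_top sequentially" for e
    unfolding filterlim_at_top eventually_sequentially
    by (intro allI, rule_tac x = "nat (int Z - e)" in exI) auto
  have lim: "(\<lambda>M. qpoch q q (nat (int M + e))) \<longlonglongrightarrow> L" for e
    by (rule filterlim_compose[OF L(2) at_top])
  have "(\<lambda>M. qpoch q q (nat (int M + d))
            / (qpoch q q b * qpoch q q (nat (int M + (d - int b)))))
        \<longlonglongrightarrow> L / (qpoch q q b * L)"
    using L(1) qpoch_nonzero[OF assms]
    by (intro tendsto_divide lim tendsto_mult tendsto_const) auto
  moreover have "eventually (\<lambda>M. qpoch q q (nat (int M + d))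
            / (qpoch q q b * qpoch q q (nat (int M + (d - int b))))
          = gauss_binomial q (int M + d) (int b)) sequentially"
    using eventually_ge_at_top[of "nat (int b - d)"]
    by eventually_elim (auto simp: gauss_binomial_def algebra_simps)
  ultimately show ?thesis
    using L(1) by (auto intro: Lim_transform_eventually)
qed

section \<open>Reversal of the finite sum\<close>

text \<open>The term of \<open>S q N\<close> at \<open>(m, n)\<close>, with \<open>A\<close> for \<open>N + 1\<close> and \<open>K\<close> for
  \<open>\<lfloor>2 (N + 2) / 3\<rfloor>\<close>; the indices are arbitrary integers, and the
  term vanishes as soon as one of them is negative.\<close>

definition S_term :: "complex \<Rightarrow> int \<Rightarrow> int \<Rightarrow> int \<times> int \<Rightarrow> complex" where
  "S_term q A K = (\<lambda>(m, n).
     q powi (m\<^sup>2 + 3 * m * n + 3 * n\<^sup>2 - n)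
     * gauss_binomial q (A - 3 * n - m) m * gauss_binomial (q ^ 3) (K - m - n) n)"

text \<open>The term at \<open>(a, b)\<close> of the reversed sum, with \<open>c\<close> for \<open>3 K - 2 A\<close> and \<open>d\<close> for
  \<open>2 K - A\<close>.\<close>

definition reversed_term :: "complex \<Rightarrow> int \<Rightarrow> int \<Rightarrow> int \<times> int \<Rightarrow> complex" where
  "reversed_term q c d = (\<lambda>(a, b).
     q powi (a\<^sup>2 - 3 * a * b + 3 * b\<^sup>2 + a - 2 * b)
     * gauss_binomial q (3 * b - a - c) a * gauss_binomial (q ^ 3) (d + a - b) b)"

text \<open>Since \<open>a\<close> and \<open>b\<close> are the complementary lower indices of the two binomials, each
  binomial keeps its upper index and changes only by symmetry.  The exponents agree identically in \<open>m\<close>, \<open>n\<close>, \<open>A\<close> and \<open>K\<close>.\<close>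

lemma S_term_inverse:
  fixes q :: complex and m n A K :: int
  assumes "q \<noteq> 0"
  defines "a \<equiv> A - 3 * n - 2 * m" and "b \<equiv> K - m - 2 * n"
  shows "S_term (inverse q) A K (m, n) * q powi (A\<^sup>2 - 3 * A * K + 3 * K\<^sup>2 + A - 2 * K)
       = reversed_term q (3 * K - 2 * A) (2 * K - A) (a, b)"
proof -
  have top1: "gauss_binomial q (3 * b - a - (3 * K - 2 * A)) a
      = gauss_binomial q (A - 3 * n - m) m"
    using gauss_binomial_symmetric[of q "A - 3 * n - m" m]
    by (simp add: a_def b_def algebra_simps)
  have top2: "gauss_binomial (q ^ 3) (2 * K - A + a - b) b
      = gauss_binomial (q ^ 3) (K - m - n) n"
    using gauss_binomial_symmetric[of "q ^ 3" "K - m - n" n]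
    by (simp add: a_def b_def algebra_simps)
  have inv1: "gauss_binomial (inverse q) (A - 3 * n - m) m
      = q powi (- (m * a)) * gauss_binomial q (A - 3 * n - m) m"
    by (simp add: gauss_binomial_inverse[OF assms(1)] a_def algebra_simps)
  have "(q ^ 3) powi (- (n * b)) = q powi (- (3 * (n * b)))"
    using power_int_mult[of q 3 "- (n * b)"] by simp
  hence inv2: "gauss_binomial (inverse q ^ 3) (K - m - n) n
      = q powi (- (3 * (n * b))) * gauss_binomial (q ^ 3) (K - m - n) n"
    using gauss_binomial_inverse[of "q ^ 3" "K - m - n" n] assms(1)
    by (simp add: b_def algebra_simps power_inverse)
  have inv3: "inverse q powi (m\<^sup>2 + 3 * m * n + 3 * n\<^sup>2 - n)
      = q powi (- (m\<^sup>2 + 3 * m * n + 3 * n\<^sup>2 - n))"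
    by (simp only: power_int_inverse power_int_minus)
  have "- (m\<^sup>2 + 3 * m * n + 3 * n\<^sup>2 - n) + - (m * a) + - (3 * (n * b))
      + (A\<^sup>2 - 3 * A * K + 3 * K\<^sup>2 + A - 2 * K) = a\<^sup>2 - 3 * a * b + 3 * b\<^sup>2 + a - 2 * b"
    unfolding a_def b_def by (simp add: power2_eq_square algebra_simps)
  hence exponents: "q powi (- (m\<^sup>2 + 3 * m * n + 3 * n\<^sup>2 - n)) * q powi (- (m * a))
      * q powi (- (3 * (n * b))) * q powi (A\<^sup>2 - 3 * A * K + 3 * K\<^sup>2 + A - 2 * K)
      = q powi (a\<^sup>2 - 3 * a * b + 3 * b\<^sup>2 + a - 2 * b)"
    using assms(1) by (simp flip: power_int_add)
  show ?thesis
    unfolding S_term_def reversed_term_def prod.case top1 top2 inv1 inv2 inv3 exponents[symmetric]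
    by (simp only: ac_simps)
qed

lemma infsum_nat_pairs:
  fixes f :: "int \<times> int \<Rightarrow> complex"
  assumes "\<And>m n. m < 0 \<or> n < 0 \<Longrightarrow> f (m, n) = 0"
  shows "(\<Sum>\<^sub>\<infinity>(m, n)\<in>UNIV. f (int m, int n)) = infsum f UNIV"
proof -
  have "(\<Sum>\<^sub>\<infinity>(m, n)\<in>UNIV. f (int m, int n)) = infsum f ({0..} \<times> {0..})"
    by (rule infsum_reindex_bij_witness[of _ "map_prod nat nat" "map_prod int int"]) auto
  also have "\<dots> = infsum f UNIV"
    using assms by (intro infsum_cong_neutral) force+
  finally show ?thesis .
qed

lemma S_inverse_eq:
  fixes q :: complex and N :: nat
  assumes "q \<noteq> 0"
  defines "A \<equiv> int N + 1" and "K \<equiv> \<lfloor>2 / 3 * (real N + 2)\<rfloor>"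
  shows "S (inverse q) N * q powi (A\<^sup>2 - 3 * A * K + 3 * K\<^sup>2 + A - 2 * K)
       = (\<Sum>\<^sub>\<infinity>(a, b)\<in>UNIV. reversed_term q (3 * K - 2 * A) (2 * K - A) (int a, int b))"
    (is "_ * ?w = _")
proof -
  have "S (inverse q) N = (\<Sum>\<^sub>\<infinity>(m, n)\<in>UNIV. S_term (inverse q) A K (int m, int n))"
    by (simp add: S_def S_term_def A_def K_def)
  also have "\<dots> = infsum (S_term (inverse q) A K) UNIV"
    by (rule infsum_nat_pairs) (auto simp: S_term_def gauss_binomial_def)
  finally have "S (inverse q) N * ?w = (\<Sum>\<^sub>\<infinity>x\<in>UNIV. S_term (inverse q) A K x * ?w)"
    by (simp add: infsum_cmult_left')
  also have "\<dots> = infsum (reversed_term q (3 * K - 2 * A) (2 * K - A)) UNIV"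
    by (rule infsum_reindex_bij_witness[of _
          "\<lambda>(a, b). (3 * b - 2 * a - 3 * K + 2 * A, 2 * K - A - 2 * b + a)"
          "\<lambda>(m, n). (A - 3 * n - 2 * m, K - m - 2 * n)"])
       (auto simp: S_term_inverse[OF assms(1)])
  also have "\<dots> = (\<Sum>\<^sub>\<infinity>(a, b)\<in>UNIV. reversed_term q (3 * K - 2 * A) (2 * K - A) (int a, int b))"
    by (rule infsum_nat_pairs[symmetric]) (auto simp: reversed_term_def gauss_binomial_def)
  finally show ?thesis .
qed

section \<open>Passage to the limit\<close>

text \<open>Tannery's theorem for sums over an arbitrary index set.\<close>

lemma infsum_dominated_convergence:
  fixes f :: "'a \<Rightarrow> nat \<Rightarrow> 'b :: banach"
  assumes "\<And>x. x \<in> X \<Longrightarrow> f x \<longlonglongrightarrow> g x"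
    and "\<And>x M. x \<in> X \<Longrightarrow> norm (f x M) \<le> h x"
    and "h summable_on X"
  shows "g summable_on X" "(\<lambda>M. \<Sum>\<^sub>\<infinity>x\<in>X. f x M) \<longlonglongrightarrow> infsum g X"
proof -
  have "norm (g x) \<le> h x" if "x \<in> X" for x
  proof (rule LIMSEQ_le_const2)
    show "(\<lambda>M. norm (f x M)) \<longlonglongrightarrow> norm (g x)"
      by (rule tendsto_norm[OF assms(1)[OF that]])
    show "\<exists>N. \<forall>M\<ge>N. norm (f x M) \<le> h x"
      using assms(2)[OF that] by blast
  qed
  with assms(3) show g: "g summable_on X"
    by (rule abs_summable_summable[OF Infinite_Sum.abs_summable_on_comparison_test'])
  have f_sums: "\<forall>\<^sub>F Y in finite_subsets_at_top X. (\<lambda>M. \<Sum>x\<in>Y. f x M) \<longlonglongrightarrow> sum g Y"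
    using assms(1) by (intro eventually_finite_subsets_at_top_weakI tendsto_sum) blast
  have g_sums: "(sum g \<longlongrightarrow> infsum g X) (finite_subsets_at_top X)"
    using has_sum_infsum[OF g] by (simp only: has_sum_def)
  have uniform: "uniform_limit UNIV (\<lambda>Y M. \<Sum>x\<in>Y. f x M) (\<lambda>M. \<Sum>\<^sub>\<infinity>x\<in>X. f x M)
      (finite_subsets_at_top X)"
    by (rule Weierstrass_m_test_general[OF assms(2,3)])
  show "(\<lambda>M. \<Sum>\<^sub>\<infinity>x\<in>X. f x M) \<longlonglongrightarrow> infsum g X"
    by (rule swap_uniform_limit'[OF f_sums g_sums uniform]) simp_all
qed

lemma exponent_lower_bound:
  fixes a b :: int
  shows "a\<^sup>2 - 3 * a * b + 3 * b\<^sup>2 + a - 2 * b \<ge> a + b - 3"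
proof -
  have "4 * (a\<^sup>2 - 3 * a * b + 3 * b\<^sup>2 - 3 * b + 3) = (2 * a - 3 * b)\<^sup>2 + 3 * (b - 2)\<^sup>2"
    by (simp add: power2_eq_square algebra_simps)
  also have "\<dots> \<ge> 0"
    by simp
  finally have "0 \<le> a\<^sup>2 - 3 * a * b + 3 * b\<^sup>2 - 3 * b + 3"
    by simp
  thus ?thesis
    by linarith
qed

lemma summable_on_geometric_pairs:
  fixes r :: real
  assumes "0 \<le> r" "r < 1"
  shows "(\<lambda>(a, b). r ^ a * r ^ b) summable_on (UNIV :: (nat \<times> nat) set)"
proof -
  have geo: "(\<lambda>n. r ^ n) summable_on UNIV"
    using assms by (intro norm_summable_imp_summable_on) (auto simp: summable_geometric)
  have "(\<lambda>(a, b). r ^ a * r ^ b) summable_on (Sigma UNIV (\<lambda>_. UNIV))"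
  proof (rule summable_on_SigmaI)
    show "((\<lambda>b. case (a, b) of (a, b) \<Rightarrow> r ^ a * r ^ b) has_sum r ^ a * (\<Sum>\<^sub>\<infinity>b. r ^ b)) UNIV" for a
      using has_sum_cmult_right[OF has_sum_infsum[OF geo]] by simp
    show "(\<lambda>a. r ^ a * (\<Sum>\<^sub>\<infinity>b. r ^ b)) summable_on UNIV"
      by (rule summable_on_cmult_left[OF geo])
  qed (use assms in auto)
  thus ?thesis
    by simp
qed

lemma reversed_sum_tendsto:
  fixes q :: complex
  assumes "0 < norm q" "norm q < 1"
  shows "limit_term q c summable_on UNIV"
    and "(\<lambda>M. \<Sum>\<^sub>\<infinity>(a, b)\<in>UNIV. reversed_term q c (int M + d) (int a, int b))
           \<longlonglongrightarrow> infsum (limit_term q c) UNIV"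
proof -
  have q3: "norm (q ^ 3) < 1"
    using assms by (simp add: norm_power power_less_one_iff)
  obtain C where C: "C > 0" "\<And>k l. norm (gauss_binomial q k l) \<le> C"
    using gauss_binomial_bounded[OF assms(2)] by metis
  obtain B where B: "B > 0" "\<And>k l. norm (gauss_binomial (q ^ 3) k l) \<le> B"
    using gauss_binomial_bounded[OF q3] by metis
  define r where "r = norm q"
  define f where "f = (\<lambda>(a, b) M. reversed_term q c (int M + d) (int a, int b))"
  define h where "h = (\<lambda>(a :: nat, b :: nat). r ^ a * r ^ b * (r powi (-3) * C * B))"
  have r: "0 < r" "r < 1"
    using assms by (auto simp: r_def)
  have lim: "f x \<longlonglongrightarrow> limit_term q c x" for x
  proof -
    obtain a b where x: "x = (a, b)"
      by (cases x)
    have "(\<lambda>M. gauss_binomial (q ^ 3) (int M + (d + int a - int b)) (int b))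
        \<longlonglongrightarrow> 1 / qpoch (q ^ 3) (q ^ 3) b"
      by (rule gauss_binomial_tendsto[OF q3])
    from tendsto_mult_left[OF this, of
        "q powi ((int a)\<^sup>2 - 3 * int a * int b + 3 * (int b)\<^sup>2 + int a - 2 * int b)
         * gauss_binomial q (3 * int b - int a - c) (int a)"]
    show ?thesis
      by (simp add: f_def x reversed_term_def limit_term_def algebra_simps)
  qed
  have bound: "norm (f x M) \<le> h x" for x M
  proof -
    obtain a b where x: "x = (a, b)"
      by (cases x)
    let ?e = "(int a)\<^sup>2 - 3 * int a * int b + 3 * (int b)\<^sup>2 + int a - 2 * int b"
    have "norm (f x M) \<le> r powi ?e * C * B"
      unfolding f_def x reversed_term_def r_def using C B
      by (auto simp: norm_mult norm_power_int intro!: mult_mono)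
    moreover have "r powi ?e \<le> r powi (int a + int b + (-3))"
      using r exponent_lower_bound[of "int a" "int b"] by (intro power_int_decreasing) auto
    moreover have "r powi (int a + int b + (-3)) = r ^ a * r ^ b * r powi (-3)"
      using r power_int_add[of r "int a + int b" "-3"] power_int_add[of r "int a" "int b"] by simp
    ultimately have "norm (f x M) \<le> r ^ a * r ^ b * r powi (-3) * C * B"
      using B(1) C(1) by (smt (verit) mult_right_mono)
    thus ?thesis
      by (simp add: h_def x mult.assoc)
  qed
  have sum: "h summable_on UNIV"
    using summable_on_cmult_left[OF summable_on_geometric_pairs[of r], of "r powi (-3) * C * B"] r
    by (simp add: h_def case_prod_unfold)
  show "limit_term q c summable_on UNIV"
    by (rule infsum_dominated_convergence(1)[OF lim bound sum])
  show "(\<lambda>M. \<Sum>\<^sub>\<infinity>(a, b)\<in>UNIV. reversed_term q c (int M + d) (int a, int b))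
           \<longlonglongrightarrow> infsum (limit_term q c) UNIV"
    using infsum_dominated_convergence(2)[OF lim bound sum]
    by (simp add: f_def case_prod_unfold)
qed

text \<open>The limit along one residue class \<open>N = 3 M + s\<close>, in which
  \<open>\<lfloor>2 (N + 2) / 3\<rfloor> = 2 M + k\<close>.\<close>

lemma S_inverse_tendsto:
  fixes q :: complex and N :: "nat \<Rightarrow> nat" and k s c :: int
  assumes "0 < norm q" "norm q < 1"
    and N: "\<And>M. int (N M) = 3 * int M + s"
    and K: "\<And>M. \<lfloor>2 / 3 * (real (N M) + 2)\<rfloor> = 2 * int M + k"
    and c: "c = 3 * k - 2 * s - 2"
    and E: "\<And>M. int (E M) = (int (N M) + 1)\<^sup>2 - 3 * (int (N M) + 1) * (2 * int M + k)
      + 3 * (2 * int M + k)\<^sup>2 + (int (N M) + 1) - 2 * (2 * int M + k)"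
  shows "limit_term q c summable_on UNIV
    \<and> (\<lambda>M. S (inverse q) (N M) * q ^ E M) \<longlonglongrightarrow> infsum (limit_term q c) UNIV"
proof -
  have "S (inverse q) (N M) * q ^ E M
      = (\<Sum>\<^sub>\<infinity>(a, b)\<in>UNIV. reversed_term q c (int M + (2 * k - s - 1)) (int a, int b))" for M
  proof -
    have c': "3 * (2 * int M + k) - 2 * (int (N M) + 1) = c"
      and d': "2 * (2 * int M + k) - (int (N M) + 1) = int M + (2 * k - s - 1)"
      by (simp_all add: N c)
    have "q \<noteq> 0"
      using assms(1) by auto
    from S_inverse_eq[OF this, of "N M"] show ?thesis
      unfolding K c' d' E[symmetric] power_int_of_nat .
  qed
  thus ?thesis
    using reversed_sum_tendsto[OF assms(1,2)] by presburger
qed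

theorem theorem5p3:
  fixes q :: complex
  assumes "0 < norm q" and "norm q < 1"
  shows
    "(limit_term q 2 summable_on UNIV
      \<and> (\<lambda>M. S (inverse q) (3 * M + 1) * q ^ ((M + 1) * (3 * M + 2)))
          \<longlonglongrightarrow> infsum (limit_term q 2) UNIV)
   \<and> (limit_term q 1 summable_on UNIV
      \<and> (\<lambda>M. S (inverse q) (3 * M) * q ^ (M * (3 * M + 2)))
          \<longlonglongrightarrow> infsum (limit_term q 1) UNIV)
   \<and> (limit_term q 0 summable_on UNIV
      \<and> (\<lambda>M. S (inverse q) (3 * M + 2) * q ^ ((M + 1) * (3 * M + 2)))
          \<longlonglongrightarrow> infsum (limit_term q 0) UNIV)"
  \<comment> \<open>The instantiations keep each pair of summability and limit together.\<close>
proof (intro conjI[where P = "_ \<and> _"] conjI[where Q = "_ \<and> _"])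
  show "limit_term q 2 summable_on UNIV
      \<and> (\<lambda>M. S (inverse q) (3 * M + 1) * q ^ ((M + 1) * (3 * M + 2)))
          \<longlonglongrightarrow> infsum (limit_term q 2) UNIV"
    by (rule S_inverse_tendsto[OF assms, where s = 1 and k = 2])
       (simp, simp add: floor_eq_iff, simp, simp add: power2_eq_square algebra_simps)
  show "limit_term q 1 summable_on UNIV
      \<and> (\<lambda>M. S (inverse q) (3 * M) * q ^ (M * (3 * M + 2)))
          \<longlonglongrightarrow> infsum (limit_term q 1) UNIV"
    by (rule S_inverse_tendsto[OF assms, where s = 0 and k = 1])
       (simp, simp add: floor_eq_iff, simp, simp add: power2_eq_square algebra_simps)
  show "limit_term q 0 summable_on UNIV
      \<and> (\<lambda>M. S (inverse q) (3 * M + 2) * q ^ ((M + 1) * (3 * M + 2)))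
          \<longlonglongrightarrow> infsum (limit_term q 0) UNIV"
    by (rule S_inverse_tendsto[OF assms, where s = 2 and k = 2])
       (simp, simp add: floor_eq_iff, simp, simp add: power2_eq_square algebra_simps)
qed

end
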